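(* Let $M$ be a compact smooth manifold. Let $X_i\in\mathrm{An}(M)$ be a sequence of Anosov vector fields with flows $\varphi^t_{X_i}$, let $Y\in\mathrm{An}(M)$ be an Anosov vector field with flow $\psi=(\varphi^t_Y)$, and let $\theta=(\theta_t)$ be a continuous flow generated by a vector field $X\in C^0(TM)$. Assume that: (i) for every $T>0$, $\sup_{t\in[-T,T]}d_{C^0}(\varphi^t_{X_i},\theta_t)\to0$ as $i\to\infty$; (ii) $d_{\mathrm{An}}(X_i,Y)\to0$ as $i\to\infty$. Then $X=Y$ and $\theta=\psi$. In particular, $\theta$ is an Anosov flow.
   Context: $M$ is compact without boundary with a fixed auxiliary Riemannian metric $g$, and $d_{C^0}$ is the uniform distance between maps of $M$. A flow $\varphi^t$ generated by a $C^r$ vector field $X$ ($r\ge1$) is Anosov if there are a continuous $d\varphi^t$-invariant splitting $TM=E^s\oplus E^u\oplus\mathbb{R}X$ and constants $C,\lambda>0$ such that for all $t>0$, $\|d\varphi^tv\|_g\le Ce^{-\lambda t}\|v\|_g$ for $v\in E^s$ and $\|d\varphi^{-t}v\|_g\le Ce^{-\lambda t}\|v\|_g$ for $v\in E^u$. $\mathrm{An}(M)\subset C^r(TM)$, $r\ge1$, is the (open) set of $C^r$ vector fields generating Anosov flows. The metric is $d_{\mathrm{An}}(X_0,X_1)=\inf\int_0^1\|dX_s/ds\|_{C^0}\,ds$ over all $C^1$ paths $[0,1]\to\mathrm{An}(M)$ from $X_0$ to $X_1$ (and $\infty$ if they lie in different path components), where $\|Y\|_{C^0}=\sup_{x\in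 M}|Y(x)|_g$. *)

theory Defs
  imports "HOL-Analysis.Analysis"
begin

section \<open>Functions of class C^r on open subsets of a Euclidean space\<close>

text \<open>Iterated directional derivatives, taken in the order in which the directions are listed.\<close>

primrec iter_deriv ::
  "'a list \<Rightarrow> ('a::euclidean_space \<Rightarrow> 'b::real_normed_vector) \<Rightarrow> 'a \<Rightarrow> 'b" where
  "iter_deriv [] f = f"
| "iter_deriv (v # vs) f = iter_deriv vs (\<lambda>x. frechet_derivative f (at x) v)"

text \<open>Only used for open \<open>S\<close>. The case \<open>r = \<infinity>\<close> is smoothness, \<open>r = 0\<close> is continuity.\<close>

definition Cr_on ::
  "enat \<Rightarrow> 'a set \<Rightarrow> ('a::euclidean_space \<Rightarrow> 'b::real_normed_vector) \<Rightarrow> bool" where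
  "Cr_on r S f \<longleftrightarrow>
     (\<forall>vs. enat (length vs) \<le> r \<longrightarrow> continuous_on S (iter_deriv vs f)) \<and>
     (\<forall>vs. enat (length vs) < r \<longrightarrow> (\<forall>x\<in>S. iter_deriv vs f differentiable (at x)))"

section \<open>Smooth manifolds\<close>

text \<open>
  The manifold is the whole type \<open>'m\<close>; the model space is \<open>'e\<close>, so its dimension is \<open>DIM('e)\<close>,
  and there is no boundary. A chart is its domain together with a map, whose values off the domain
  are irrelevant. A smooth structure is given by an atlas, which need not be maximal.
\<close>

type_synonym ('m, 'e) chart = "'m set \<times> ('m \<Rightarrow> 'e)"

abbreviation cdom :: "('m, 'e) chart \<Rightarrow> 'm set" where
  "cdom c \<equiv> fst c"

abbreviation cmap :: "('m, 'e) chart \<Rightarrow> 'm \<Rightarrow> 'e" where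
  "cmap c \<equiv> snd c"

definition cimage :: "('m, 'e) chart \<Rightarrow> 'e set" where
  "cimage c = cmap c ` cdom c"

definition cinv :: "('m, 'e) chart \<Rightarrow> 'e \<Rightarrow> 'm" where
  "cinv c = inv_into (cdom c) (cmap c)"

definition smooth_atlas ::
  "('m::{t2_space,second_countable_topology}, 'e::euclidean_space) chart set \<Rightarrow> bool" where
  "smooth_atlas A \<longleftrightarrow>
     (\<forall>c\<in>A. open (cdom c) \<and> open (cimage c) \<and>
            homeomorphism (cdom c) (cimage c) (cmap c) (cinv c)) \<and>
     (\<Union>c\<in>A. cdom c) = UNIV \<and>
     (\<forall>c\<in>A. \<forall>d\<in>A. Cr_on \<infinity> (cmap c ` (cdom c \<inter> cdom d)) (cmap d \<circ> cinv c))"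

section \<open>Tangent vectors\<close>

text \<open>
  A tangent vector at \<open>p\<close> is an equivalence class of pairs (chart at \<open>p\<close>, vector of the model
  space), two pairs being identified by the derivative of the transition map. Such a class has
  exactly one representative in the chosen chart \<open>chart_at A p\<close>, and it is encoded by the vector of
  that representative. Thus every tangent space is a copy of \<open>'e\<close>, a vector field is a
  function \<open>'m \<Rightarrow> 'e\<close>, and the vector space operations on vector fields are pointwise. Since
  \<open>chart_at A p\<close> does not depend continuously on \<open>p\<close>, the regularity of vector fields and tensors
  must always be expressed by means of their components in the charts of the atlas.
\<close>

definition chart_at :: "('m, 'e) chart set \<Rightarrow> 'm \<Rightarrow> ('m, 'e) chart" where
  "chart_at A p = (SOME c. c \<in> A \<and> p \<in> cdom c)"

definition coord_change ::
  "('m, 'e::euclidean_space) chart \<Rightarrow> ('m, 'e) chart \<Rightarrow> 'm \<Rightarrow> 'e \<Rightarrow> 'e" where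
  "coord_change c d p = frechet_derivative (cmap d \<circ> cinv c) (at (cmap c p))"

text \<open>The components in the chart \<open>c\<close> of a tangent vector at \<open>p\<close>, and the tangent vector at \<open>p\<close>
  with given components.\<close>

definition tcoord ::
  "('m, 'e::euclidean_space) chart set \<Rightarrow> ('m, 'e) chart \<Rightarrow> 'm \<Rightarrow> 'e \<Rightarrow> 'e" where
  "tcoord A c p = coord_change (chart_at A p) c p"

definition tvec ::
  "('m, 'e::euclidean_space) chart set \<Rightarrow> ('m, 'e) chart \<Rightarrow> 'm \<Rightarrow> 'e \<Rightarrow> 'e" where
  "tvec A c p = coord_change c (chart_at A p) p"

definition tangent_map ::
  "('m, 'e::euclidean_space) chart set \<Rightarrow> ('m \<Rightarrow> 'm) \<Rightarrow> 'm \<Rightarrow> 'e \<Rightarrow> 'e" where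
  "tangent_map A f p =
     frechet_derivative (cmap (chart_at A (f p)) \<circ> f \<circ> cinv (chart_at A p))
       (at (cmap (chart_at A p) p))"

text \<open>\<open>v\<close> is the velocity at time \<open>t\<close> of the curve \<open>\<gamma>\<close>, restricted to the times in \<open>S\<close>; a
  one-sided derivative if \<open>t\<close> is an end point of the interval \<open>S\<close>. The curve \<open>\<gamma>\<close> must be
  continuous for this to be meaningful.\<close>

definition has_velocity ::
  "('m, 'e::euclidean_space) chart set \<Rightarrow> (real \<Rightarrow> 'm) \<Rightarrow> 'e \<Rightarrow> real \<Rightarrow> real set \<Rightarrow> bool" where
  "has_velocity A \<gamma> v t S \<longleftrightarrow>
     ((\<lambda>s. cmap (chart_at A (\<gamma> t)) (\<gamma> s)) has_vector_derivative v) (at t within S)"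

section \<open>Vector fields\<close>

definition vf_rep ::
  "('m, 'e::euclidean_space) chart set \<Rightarrow> ('m, 'e) chart \<Rightarrow> ('m \<Rightarrow> 'e) \<Rightarrow> 'e \<Rightarrow> 'e" where
  "vf_rep A c X = (\<lambda>y. tcoord A c (cinv c y) (X (cinv c y)))"

definition Cr_vector_field ::
  "('m, 'e::euclidean_space) chart set \<Rightarrow> enat \<Rightarrow> ('m \<Rightarrow> 'e) \<Rightarrow> bool" where
  "Cr_vector_field A r X \<longleftrightarrow> (\<forall>c\<in>A. Cr_on r (cimage c) (vf_rep A c X))"

definition continuous_vf_on ::
  "('m::topological_space, 'e::euclidean_space) chart set \<Rightarrow> 'm set \<Rightarrow> ('m \<Rightarrow> 'e) \<Rightarrow> bool" where
  "continuous_vf_on A U X \<longleftrightarrow>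
     (\<forall>c\<in>A. continuous_on (U \<inter> cdom c) (\<lambda>p. tcoord A c p (X p)))"

text \<open>Convergence in the C^r topology: uniform convergence, on compact subsets of charts, of the
  components and of their partial derivatives of order at most \<open>r\<close>.\<close>

definition Cr_tendsto ::
  "('m, 'e::euclidean_space) chart set \<Rightarrow> enat \<Rightarrow> ('i \<Rightarrow> 'm \<Rightarrow> 'e) \<Rightarrow> ('m \<Rightarrow> 'e) \<Rightarrow> 'i filter \<Rightarrow> bool"
  where
  "Cr_tendsto A r W Z F \<longleftrightarrow>
     (\<forall>c\<in>A. \<forall>K. compact K \<and> K \<subseteq> cimage c \<longrightarrow>
       (\<forall>vs. enat (length vs) \<le> r \<longrightarrow>
         uniform_limit K (\<lambda>i. iter_deriv vs (vf_rep A c (W i))) (iter_deriv vs (vf_rep A c Z)) F))"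

text \<open>\<open>P\<close> is a C^1 path in the topological vector space of C^r vector fields, parametrised
  by \<open>[0,1]\<close>, with derivative \<open>Z = dP/ds\<close>.\<close>

definition C1_path_vf ::
  "('m, 'e::euclidean_space) chart set \<Rightarrow> enat \<Rightarrow> (real \<Rightarrow> 'm \<Rightarrow> 'e) \<Rightarrow> (real \<Rightarrow> 'm \<Rightarrow> 'e) \<Rightarrow> bool" where
  "C1_path_vf A r P Z \<longleftrightarrow>
     (\<forall>s\<in>{0..1}. Cr_vector_field A r (P s) \<and> Cr_vector_field A r (Z s) \<and>
        Cr_tendsto A r (\<lambda>u x. (P u x - P s x) /\<^sub>R (u - s)) (Z s) (at s within {0..1}) \<and>
        Cr_tendsto A r Z (Z s) (at s within {0..1}))"

section \<open>Riemannian metrics and the associated distances\<close>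

definition riemannian_metric ::
  "('m, 'e::euclidean_space) chart set \<Rightarrow> ('m \<Rightarrow> 'e \<Rightarrow> 'e \<Rightarrow> real) \<Rightarrow> bool" where
  "riemannian_metric A g \<longleftrightarrow>
     (\<forall>p. bilinear (g p) \<and> (\<forall>u v. g p u v = g p v u) \<and> (\<forall>v. v \<noteq> 0 \<longrightarrow> g p v v > 0)) \<and>
     (\<forall>c\<in>A. \<forall>u v. Cr_on \<infinity> (cimage c)
        (\<lambda>y. g (cinv c y) (tvec A c (cinv c y) u) (tvec A c (cinv c y) v)))"

definition gnorm :: "('m \<Rightarrow> 'e \<Rightarrow> 'e \<Rightarrow> real) \<Rightarrow> 'm \<Rightarrow> 'e \<Rightarrow> real" where
  "gnorm g p v = sqrt (g p v v)"

definition C1_curve ::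
  "('m::topological_space, 'e::euclidean_space) chart set \<Rightarrow> real set \<Rightarrow> (real \<Rightarrow> 'm) \<Rightarrow> (real \<Rightarrow> 'e) \<Rightarrow> bool"
  where
  "C1_curve A S \<gamma> v \<longleftrightarrow>
     continuous_on S \<gamma> \<and>
     (\<forall>t\<in>S. has_velocity A \<gamma> (v t) t S) \<and>
     (\<forall>c\<in>A. continuous_on {t\<in>S. \<gamma> t \<in> cdom c} (\<lambda>t. tcoord A c (\<gamma> t) (v t)))"

text \<open>The infimum of the lengths of the piecewise C^1 curves from \<open>p\<close> to \<open>q\<close>, where \<open>v i\<close> is the
  velocity on the \<open>i\<close>-th piece. The value is \<open>\<infinity>\<close> if \<open>p\<close> and \<open>q\<close> lie in different components.\<close>

definition riemannian_dist ::
  "('m::topological_space, 'e::euclidean_space) chart set \<Rightarrow> ('m \<Rightarrow> 'e \<Rightarrow> 'e \<Rightarrow> real) \<Rightarrow> 'm \<Rightarrow> 'm \<Rightarrow> ennreal"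
  where
  "riemannian_dist A g p q =
     Inf {(\<Sum>i<n. \<integral>\<^sup>+t\<in>{\<tau> i..\<tau> (Suc i)}. ennreal (gnorm g (\<gamma> t) (v i t)) \<partial>lborel)
          | (\<gamma> :: real \<Rightarrow> 'm) (n :: nat) (\<tau> :: nat \<Rightarrow> real) (v :: nat \<Rightarrow> real \<Rightarrow> 'e).
            continuous_on {0..1} \<gamma> \<and> \<gamma> 0 = p \<and> \<gamma> 1 = q \<and>
            \<tau> 0 = 0 \<and> \<tau> n = 1 \<and>
            (\<forall>i<n. \<tau> i < \<tau> (Suc i) \<and> C1_curve A {\<tau> i..\<tau> (Suc i)} \<gamma> (v i))}"

definition C0_dist ::
  "('m::topological_space, 'e::euclidean_space) chart set \<Rightarrow> ('m \<Rightarrow> 'e \<Rightarrow> 'e \<Rightarrow> real) \<Rightarrow>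
   ('m \<Rightarrow> 'm) \<Rightarrow> ('m \<Rightarrow> 'm) \<Rightarrow> ennreal" where
  "C0_dist A g f h = (SUP x. riemannian_dist A g (f x) (h x))"

definition C0_norm :: "('m \<Rightarrow> 'e \<Rightarrow> 'e \<Rightarrow> real) \<Rightarrow> ('m \<Rightarrow> 'e) \<Rightarrow> ennreal" where
  "C0_norm g Y = (SUP x. ennreal (gnorm g x (Y x)))"

section \<open>Anosov flows\<close>

definition continuous_flow :: "(real \<Rightarrow> 'm::topological_space \<Rightarrow> 'm) \<Rightarrow> bool" where
  "continuous_flow \<phi> \<longleftrightarrow>
     continuous_on UNIV (\<lambda>(t, x). \<phi> t x) \<and>
     (\<forall>x. \<phi> 0 x = x) \<and> (\<forall>s t x. \<phi> (s + t) x = \<phi> s (\<phi> t x))"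

definition generates ::
  "('m::topological_space, 'e::euclidean_space) chart set \<Rightarrow> ('m \<Rightarrow> 'e) \<Rightarrow> (real \<Rightarrow> 'm \<Rightarrow> 'm) \<Rightarrow> bool" where
  "generates A X \<phi> \<longleftrightarrow>
     continuous_flow \<phi> \<and> (\<forall>x t. has_velocity A (\<lambda>s. \<phi> s x) (X (\<phi> t x)) t UNIV)"

text \<open>A continuous vector subbundle of the tangent bundle: locally spanned by a continuous frame.\<close>

definition continuous_subbundle ::
  "('m::topological_space, 'e::euclidean_space) chart set \<Rightarrow> ('m \<Rightarrow> 'e set) \<Rightarrow> bool" where
  "continuous_subbundle A E \<longleftrightarrow>
     (\<forall>x. \<exists>U (k :: nat) (e :: nat \<Rightarrow> 'm \<Rightarrow> 'e).
        open U \<and> x \<in> U \<and> (\<forall>i<k. continuous_vf_on A U (e i)) \<and>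
        (\<forall>y\<in>U. inj_on (\<lambda>i. e i y) {..<k} \<and> independent ((\<lambda>i. e i y) ` {..<k}) \<and>
               E y = span ((\<lambda>i. e i y) ` {..<k})))"

text \<open>Uniqueness of the coefficient \<open>k\<close> includes that \<open>X\<close> has no zeros, i.e. that the
  summand spanned by \<open>X\<close> is a line bundle.\<close>

definition anosov_splitting ::
  "('m::topological_space, 'e::euclidean_space) chart set \<Rightarrow> ('m \<Rightarrow> 'e \<Rightarrow> 'e \<Rightarrow> real) \<Rightarrow>
   ('m \<Rightarrow> 'e) \<Rightarrow> (real \<Rightarrow> 'm \<Rightarrow> 'm) \<Rightarrow> ('m \<Rightarrow> 'e set) \<Rightarrow> ('m \<Rightarrow> 'e set) \<Rightarrow> bool" where
  "anosov_splitting A g X \<phi> Es Eu \<longleftrightarrow>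
     continuous_subbundle A Es \<and> continuous_subbundle A Eu \<and>
     (\<forall>x v. \<exists>!w. case w of (a, b, k) \<Rightarrow> a \<in> Es x \<and> b \<in> Eu x \<and> v = a + b + k *\<^sub>R X x) \<and>
     (\<forall>t x. tangent_map A (\<phi> t) x ` Es x = Es (\<phi> t x) \<and>
            tangent_map A (\<phi> t) x ` Eu x = Eu (\<phi> t x)) \<and>
     (\<exists>C>0. \<exists>\<mu>>0. \<forall>t>0. \<forall>x.
        (\<forall>v\<in>Es x. gnorm g (\<phi> t x) (tangent_map A (\<phi> t) x v)
                     \<le> C * exp (- \<mu> * t) * gnorm g x v) \<and>
        (\<forall>v\<in>Eu x. gnorm g (\<phi> (- t) x) (tangent_map A (\<phi> (- t)) x v)
                     \<le> C * exp (- \<mu> * t) * gnorm g x v))"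

definition anosov_generates ::
  "('m::topological_space, 'e::euclidean_space) chart set \<Rightarrow> ('m \<Rightarrow> 'e \<Rightarrow> 'e \<Rightarrow> real) \<Rightarrow> enat \<Rightarrow>
   ('m \<Rightarrow> 'e) \<Rightarrow> (real \<Rightarrow> 'm \<Rightarrow> 'm) \<Rightarrow> bool" where
  "anosov_generates A g r X \<phi> \<longleftrightarrow>
     Cr_vector_field A r X \<and> generates A X \<phi> \<and> (\<exists>Es Eu. anosov_splitting A g X \<phi> Es Eu)"

definition anosov_flow ::
  "('m::topological_space, 'e::euclidean_space) chart set \<Rightarrow> ('m \<Rightarrow> 'e \<Rightarrow> 'e \<Rightarrow> real) \<Rightarrow> enat \<Rightarrow>
   (real \<Rightarrow> 'm \<Rightarrow> 'm) \<Rightarrow> bool" where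
  "anosov_flow A g r \<phi> \<longleftrightarrow> (\<exists>X. anosov_generates A g r X \<phi>)"

definition An ::
  "('m::topological_space, 'e::euclidean_space) chart set \<Rightarrow> ('m \<Rightarrow> 'e \<Rightarrow> 'e \<Rightarrow> real) \<Rightarrow> enat \<Rightarrow>
   ('m \<Rightarrow> 'e) set" where
  "An A g r = {X. \<exists>\<phi>. anosov_generates A g r X \<phi>}"

text \<open>An infimum over the empty set is \<open>\<infinity>\<close>.\<close>

definition d_An ::
  "('m::topological_space, 'e::euclidean_space) chart set \<Rightarrow> ('m \<Rightarrow> 'e \<Rightarrow> 'e \<Rightarrow> real) \<Rightarrow> enat \<Rightarrow>
   ('m \<Rightarrow> 'e) \<Rightarrow> ('m \<Rightarrow> 'e) \<Rightarrow> ennreal" where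
  "d_An A g r X0 X1 =
     Inf {(\<integral>\<^sup>+s\<in>{0..1}. C0_norm g (Z s) \<partial>lborel)
          | P Z. C1_path_vf A r P Z \<and> (\<forall>s\<in>{0..1}. P s \<in> An A g r) \<and> P 0 = X0 \<and> P 1 = X1}"

end

theory Submission
  imports Defs
begin

text \<open>
  Both hypotheses are tested on orbits, inside a chart. Along a path of vector fields, the components
  at a given point move at most by a multiple of the length of the path, locally uniform in the
  point, so \<open>d_An A g r (Xs i) Y \<rightarrow> 0\<close> forces
  \<open>Xs i \<rightarrow> Y\<close> uniformly near a point \<open>x\<close> (\<open>d_An_controls_components\<close>). Similarly, convergence of the
  flows in the Riemannian distance forces convergence of the orbit of \<open>x\<close> in a chart, locally
  uniformly in time (\<open>riemannian_dist_controls_chart_dist\<close>). For short times the orbit of \<open>x\<close>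
  under \<open>\<phi> i\<close> therefore moves with a velocity close to \<open>Y x\<close>, and by the mean value inequality so
  does the limit orbit: its velocity at time \<open>0\<close> is \<open>Y x\<close>. But this velocity is \<open>X x\<close>, so
  \<open>X = Y\<close> (\<open>velocity_of_limit_flow\<close>). A \<open>C\<^sup>1\<close> vector field has only one flow
  (\<open>flow_unique\<close>), so \<open>\<theta>\<close> agrees with \<open>\<psi>\<close> and with the Anosov flow witnessing that \<open>Y\<close> belongs
  to \<open>An A g r\<close>.

  The passage from intrinsic quantities to a chart rests on one estimate: on a compact
  part of a chart, the Riemannian norm dominates a fixed multiple \<open>m\<close> of the Euclidean norm of the
  components (\<open>gnorm_lower_bound\<close>). Since a curve may leave the chart, the estimate of
  distances is applied to its part after the last time at which it is outside a coordinate ball.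
\<close>

section \<open>Charts and components of tangent vectors\<close>

lemma chart_facts:
  assumes "smooth_atlas A" "c \<in> A"
  shows "open (cdom c)" "open (cimage c)"
    "continuous_on (cdom c) (cmap c)" "continuous_on (cimage c) (cinv c)"
    "p \<in> cdom c \<Longrightarrow> cinv c (cmap c p) = p" "p \<in> cdom c \<Longrightarrow> cmap c p \<in> cimage c"
    "y \<in> cimage c \<Longrightarrow> cinv c y \<in> cdom c" "y \<in> cimage c \<Longrightarrow> cmap c (cinv c y) = y"
proof -
  have "open (cdom c) \<and> open (cimage c) \<and> homeomorphism (cdom c) (cimage c) (cmap c) (cinv c)"
    using assms unfolding smooth_atlas_def by blast
  then show "open (cdom c)" "open (cimage c)"
    "continuous_on (cdom c) (cmap c)" "continuous_on (cimage c) (cinv c)"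
    "p \<in> cdom c \<Longrightarrow> cinv c (cmap c p) = p" "p \<in> cdom c \<Longrightarrow> cmap c p \<in> cimage c"
    "y \<in> cimage c \<Longrightarrow> cinv c y \<in> cdom c" "y \<in> cimage c \<Longrightarrow> cmap c (cinv c y) = y"
    unfolding homeomorphism_def by blast+
qed

lemma chart_at:
  assumes "smooth_atlas A"
  shows "chart_at A p \<in> A" "p \<in> cdom (chart_at A p)"
proof -
  have "\<exists>c. c \<in> A \<and> p \<in> cdom c"
    using assms unfolding smooth_atlas_def by (metis UNIV_I UN_E)
  then have "chart_at A p \<in> A \<and> p \<in> cdom (chart_at A p)"
    unfolding chart_at_def by (rule someI_ex)
  then show "chart_at A p \<in> A" "p \<in> cdom (chart_at A p)" by auto
qed

lemma open_chart_image:
  assumes "smooth_atlas A" "c \<in> A" "open U" "U \<subseteq> cdom c"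
  shows "open (cmap c ` U)"
proof -
  have "homeomorphism (cdom c) (cimage c) (cmap c) (cinv c)"
    using assms unfolding smooth_atlas_def by auto
  then have "openin (top_of_set (cimage c)) (cmap c ` U)"
    using assms by (meson homeomorphism_imp_open_map openin_open_eq openin_subset open_subset)
  then show ?thesis
    using chart_facts(2)[OF assms(1,2)] by (simp add: openin_open_eq)
qed

lemma open_chart_preimage:
  assumes "smooth_atlas A" "c \<in> A" "open V" "V \<subseteq> cimage c"
  shows "open (cinv c ` V)"
proof -
  have "cinv c ` V = cmap c -` V \<inter> cdom c"
    using chart_facts[OF assms(1,2)] assms(4) by (force simp: image_iff)
  then show ?thesis
    using continuous_on_open_vimage chart_facts[OF assms(1,2)] assms(3) by metis
qed

lemma transition_derivative:
  assumes "smooth_atlas A" "c \<in> A" "d \<in> A" "p \<in> cdom c" "p \<in> cdom d"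
  shows "((cmap d \<circ> cinv c) has_derivative coord_change c d p) (at (cmap c p))"
proof -
  have "Cr_on \<infinity> (cmap c ` (cdom c \<inter> cdom d)) (cmap d \<circ> cinv c)"
    using assms unfolding smooth_atlas_def by auto
  then have "\<forall>vs. \<forall>x\<in>cmap c ` (cdom c \<inter> cdom d). iter_deriv vs (cmap d \<circ> cinv c) differentiable (at x)"
    unfolding Cr_on_def by auto
  from this[rule_format, of "cmap c p" "[]"] assms
  have "(cmap d \<circ> cinv c) differentiable (at (cmap c p))" by auto
  then show ?thesis
    unfolding coord_change_def using frechet_derivative_works by blast
qed

lemma coord_change_linear:
  assumes "smooth_atlas A" "c \<in> A" "d \<in> A" "p \<in> cdom c" "p \<in> cdom d"
  shows "linear (coord_change c d p)"
  using transition_derivative[OF assms] has_derivative_linear by blast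

lemma coord_change_refl:
  assumes "smooth_atlas A" "c \<in> A" "p \<in> cdom c"
  shows "coord_change c c p v = v"
proof -
  have "((\<lambda>y. y) has_derivative (\<lambda>v. v)) (at (cmap c p))" by simp
  then have "((cmap c \<circ> cinv c) has_derivative (\<lambda>v. v)) (at (cmap c p))"
    by (rule has_derivative_transform_within_open[where s="cimage c"])
       (use chart_facts[OF assms(1,2)] assms(3) in auto)
  from has_derivative_unique[OF this transition_derivative[OF assms(1,2,2,3,3)]]
  show ?thesis by metis
qed

lemma coord_change_trans:
  assumes "smooth_atlas A" "c \<in> A" "d \<in> A" "e \<in> A" "p \<in> cdom c" "p \<in> cdom d" "p \<in> cdom e"
  shows "coord_change d e p (coord_change c d p v) = coord_change c e p v"
proof -
  note C = chart_facts[OF assms(1,2)] and D = chart_facts[OF assms(1,3)]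
  have "((cmap e \<circ> cinv d) \<circ> (cmap d \<circ> cinv c) has_derivative coord_change d e p \<circ> coord_change c d p)
      (at (cmap c p))"
    using transition_derivative[OF assms(1,2,3,5,6)] transition_derivative[OF assms(1,3,4,6,7)]
      C(5)[OF assms(5)]
    by (intro diff_chain_at) auto
  then have "((cmap e \<circ> cinv c) has_derivative coord_change d e p \<circ> coord_change c d p) (at (cmap c p))"
    by (rule has_derivative_transform_within_open[where s="cmap c ` (cdom c \<inter> cdom d)"])
       (use C D assms open_chart_image[OF assms(1,2), of "cdom c \<inter> cdom d"] in auto)
  from has_derivative_unique[OF this transition_derivative[OF assms(1,2,4,5,7)]]
  show ?thesis by (metis comp_apply)
qed

lemma
  assumes "smooth_atlas A" "c \<in> A" "p \<in> cdom c"
  shows linear_tcoord: "linear (tcoord A c p)" and linear_tvec: "linear (tvec A c p)"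
    and tvec_tcoord: "tvec A c p (tcoord A c p v) = v" and tcoord_tvec: "tcoord A c p (tvec A c p v) = v"
  using assms chart_at[OF assms(1), of p]
  by (simp_all add: tcoord_def tvec_def coord_change_linear coord_change_trans coord_change_refl)

lemma tcoord_chart_at:
  assumes "smooth_atlas A"
  shows "tcoord A (chart_at A p) p v = v"
  using coord_change_refl[OF assms chart_at[OF assms]] by (simp add: tcoord_def)

text \<open>
  A velocity is defined by means of the chart selected at the point of the curve, which jumps along
  the curve. The chain rule for the transition map expresses it in one fixed chart.
\<close>

lemma has_velocity_in_chart:
  assumes A: "smooth_atlas A" "c \<in> A" and p: "\<gamma> t \<in> cdom c"
    and cont: "continuous_on S \<gamma>" and t: "t \<in> S" and vel: "has_velocity A \<gamma> v t S"
  shows "((\<lambda>s. cmap c (\<gamma> s)) has_vector_derivative tcoord A c (\<gamma> t) v) (at t within S)"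
proof -
  define d where "d = chart_at A (\<gamma> t)"
  have d: "d \<in> A" "\<gamma> t \<in> cdom d" using chart_at[OF A(1)] by (auto simp: d_def)
  note D = chart_facts[OF A(1) d(1)]
  have "((\<lambda>s. cmap d (\<gamma> s)) has_derivative (\<lambda>s. s *\<^sub>R v)) (at t within S)"
    using vel by (simp add: has_velocity_def d_def has_vector_derivative_def)
  moreover have "((cmap c \<circ> cinv d) has_derivative tcoord A c (\<gamma> t)) (at (cmap d (\<gamma> t)))"
    using transition_derivative[OF A(1) d(1) A(2) d(2) p] by (simp add: tcoord_def d_def)
  ultimately have "((\<lambda>s. (cmap c \<circ> cinv d) (cmap d (\<gamma> s))) has_derivative
      (\<lambda>s. tcoord A c (\<gamma> t) (s *\<^sub>R v))) (at t within S)"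
    by (rule has_derivative_compose)
  moreover have ev: "\<forall>\<^sub>F s in at t within S. \<gamma> s \<in> cdom d"
    using topological_tendstoD[OF _ D(1) d(2)] cont t unfolding continuous_on_def by blast
  have "\<forall>\<^sub>F s in at t within S. (cmap c \<circ> cinv d) (cmap d (\<gamma> s)) = cmap c (\<gamma> s)"
    using ev by eventually_elim (simp add: D)
  ultimately have "((\<lambda>s. cmap c (\<gamma> s)) has_derivative (\<lambda>s. tcoord A c (\<gamma> t) (s *\<^sub>R v))) (at t within S)"
    by (rule has_derivative_transform_eventually) (use D d t in auto)
  then show ?thesis
    by (simp add: has_vector_derivative_def linear_cmul[OF linear_tcoord[OF A p]])
qed

text \<open>
  The metric in coordinates is a continuous positive function of the pair (point, unit vector), and
  these pairs form a compact set if the points are restricted to \<open>K\<close>. Its minimum is \<open>m\<^sup>2\<close>;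
  homogeneity extends the bound to all vectors.
\<close>

lemma gnorm_lower_bound:
  assumes A: "smooth_atlas A" "c \<in> A" and g: "riemannian_metric A g"
    and K: "compact K" "K \<subseteq> cimage c"
  obtains m where "m > 0"
    "\<And>y v. y \<in> K \<Longrightarrow> m * norm (tcoord A c (cinv c y) v) \<le> gnorm g (cinv c y) v"
proof (cases "K = {}")
  case True
  then show ?thesis using that[of 1] by auto
next
  case False
  note C = chart_facts[OF A]
  have lin: "linear (tvec A c (cinv c y))" if "y \<in> K" for y
    using linear_tvec[OF A C(7)] that K by auto
  have bil: "bilinear (g p)" for p using g by (auto simp: riemannian_metric_def)
  define G where "G y u w = g (cinv c y) (tvec A c (cinv c y) u) (tvec A c (cinv c y) w)" for y u w
  have bilG: "bilinear (G y)" if "y \<in> K" for y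
    using linear_compose[OF lin[OF that], unfolded o_def] bil[of "cinv c y"]
    unfolding bilinear_def G_def by blast
  have contG: "continuous_on K (\<lambda>y. G y u w)" for u w
  proof -
    have "Cr_on \<infinity> (cimage c) (\<lambda>y. G y u w)"
      using g A(2) by (auto simp: riemannian_metric_def G_def)
    then have "continuous_on (cimage c) (iter_deriv [] (\<lambda>y. G y u w))"
      unfolding Cr_on_def by (metis enat_ord_code(3))
    then show ?thesis using K(2) continuous_on_subset by auto
  qed
  have expand: "G y w w = (\<Sum>(i,j)\<in>Basis\<times>Basis. (w \<bullet> i) * (w \<bullet> j) * G y i j)" if "y \<in> K" for y w
  proof -
    have "G y w w = G y (\<Sum>i\<in>Basis. (w \<bullet> i) *\<^sub>R i) (\<Sum>i\<in>Basis. (w \<bullet> i) *\<^sub>R i)"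
      by (simp add: euclidean_representation)
    also have "\<dots> = (\<Sum>(i,j)\<in>Basis\<times>Basis. G y ((w \<bullet> i) *\<^sub>R i) ((w \<bullet> j) *\<^sub>R j))"
      using bilinear_sum[OF bilG[OF that]] .
    finally show ?thesis
      by (simp add: bilinear_lmul[OF bilG[OF that]] bilinear_rmul[OF bilG[OF that]] mult_ac)
  qed
  have "continuous_on (K \<times> sphere 0 1)
      (\<lambda>z. \<Sum>(i,j)\<in>Basis\<times>Basis. (snd z \<bullet> i) * (snd z \<bullet> j) * G (fst z) i j)"
    unfolding split_def
    by (intro continuous_intros continuous_on_compose2[OF contG continuous_on_fst[OF continuous_on_id]]) auto
  then have cont: "continuous_on (K \<times> sphere 0 1) (\<lambda>z. G (fst z) (snd z) (snd z))"
    by (rule continuous_on_eq) (auto simp: expand)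
  have cpt: "compact (K \<times> sphere (0::'b) 1)"
    using K(1) by (intro compact_Times) auto
  have ne: "K \<times> sphere (0::'b) 1 \<noteq> {}"
    using False by simp
  obtain z where z: "z \<in> K \<times> sphere 0 1"
    and min: "\<And>z'. z' \<in> K \<times> sphere 0 1 \<Longrightarrow> G (fst z) (snd z) (snd z) \<le> G (fst z') (snd z') (snd z')"
    using continuous_attains_inf[OF cpt ne cont] by blast
  define \<mu> where "\<mu> = G (fst z) (snd z) (snd z)"
  have d: "cinv c (fst z) \<in> cdom c" using C(7) z K by auto
  have "tvec A c (cinv c (fst z)) (snd z) \<noteq> 0"
    using tcoord_tvec[OF A d, of "snd z"] linear_0[OF linear_tcoord[OF A d]] z by auto
  then have "\<mu> > 0" using g by (auto simp: \<mu>_def G_def riemannian_metric_def)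
  show ?thesis
  proof (rule that[of "sqrt \<mu>"])
    show "sqrt \<mu> > 0" using \<open>\<mu> > 0\<close> by simp
    fix y v assume y: "y \<in> K"
    define w where "w = tcoord A c (cinv c y) v"
    have v: "v = tvec A c (cinv c y) w"
      using tvec_tcoord[OF A C(7)] y K(2) by (auto simp: w_def)
    have "\<mu> * (norm w)\<^sup>2 \<le> G y w w"
    proof (cases "w = 0")
      case True
      then show ?thesis by (simp add: bilinear_lzero[OF bilG[OF y]])
    next
      case False
      have "\<mu> \<le> G y (w /\<^sub>R norm w) (w /\<^sub>R norm w)"
        using min[of "(y, w /\<^sub>R norm w)"] y False by (simp add: \<mu>_def)
      also have "\<dots> = G y w w / (norm w)\<^sup>2"
        by (simp add: bilinear_lmul[OF bilG[OF y]] bilinear_rmul[OF bilG[OF y]] power2_eq_square field_simps)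
      finally show ?thesis using False by (simp add: field_simps)
    qed
    then have "sqrt (\<mu> * (norm w)\<^sup>2) \<le> sqrt (g (cinv c y) v v)"
      by (simp add: G_def v)
    then show "sqrt \<mu> * norm (tcoord A c (cinv c y) v) \<le> gnorm g (cinv c y) v"
      by (simp add: real_sqrt_mult gnorm_def w_def)
  qed
qed

section \<open>Lengths and displacements in a chart\<close>

text \<open>
  The common core of the estimates of lengths of curves in the manifold and of lengths of paths of
  vector fields. The bound \<open>f\<close> may be non-measurable: \<open>C0_norm g (Z s)\<close> is a supremum over
  uncountably many points.
\<close>

lemma displacement_le_nn_integral:
  fixes h :: "real \<Rightarrow> 'e::euclidean_space"
  assumes ab: "a \<le> b" and m: "m > 0"
    and der: "\<And>t. t \<in> {a..b} \<Longrightarrow> (h has_vector_derivative h' t) (at t within {a..b})"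
    and cont: "continuous_on {a..b} h'"
    and le: "\<And>t. t \<in> {a..b} \<Longrightarrow> ennreal (m * norm (h' t)) \<le> f t"
  shows "ennreal (m * norm (h b - h a)) \<le> (\<integral>\<^sup>+t\<in>{a..b}. f t \<partial>lborel)"
proof -
  have i: "(h' has_integral (h b - h a)) {a..b}"
    using fundamental_theorem_of_calculus[OF ab] der by blast
  have c: "continuous_on {a..b} (\<lambda>t. m * norm (h' t))"
    using cont by (intro continuous_intros)
  then have "((\<lambda>t. m * norm (h' t)) has_integral integral {a..b} (\<lambda>t. m * norm (h' t))) {a..b}"
    by (intro integrable_integral integrable_continuous_real)
  then have nn: "(\<integral>\<^sup>+t\<in>{a..b}. ennreal (m * norm (h' t)) \<partial>lborel)
      = ennreal (integral {a..b} (\<lambda>t. m * norm (h' t)))"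
    using m c by (intro nn_integral_has_integral_lebesgue') (auto intro: borel_measurable_continuous_on_indicator)
  have "norm (h b - h a) \<le> integral {a..b} (\<lambda>t. norm (h' t))"
    using i cont by (metis integral_norm_bound_integral integrable_continuous_real
        continuous_on_norm integral_unique order_refl)
  then have "m * norm (h b - h a) \<le> integral {a..b} (\<lambda>t. m * norm (h' t))"
    using m by simp
  then have "ennreal (m * norm (h b - h a)) \<le> (\<integral>\<^sup>+t\<in>{a..b}. ennreal (m * norm (h' t)) \<partial>lborel)"
    unfolding nn by (rule ennreal_leI)
  also have "\<dots> \<le> (\<integral>\<^sup>+t\<in>{a..b}. f t \<partial>lborel)"
    using le by (intro nn_integral_mono) (auto simp: indicator_def)
  finally show ?thesis .
qed

text \<open>
  The break points are replaced by \<open>max T (\<tau> i)\<close>: the pieces before \<open>T\<close> collapse to a point, and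
  the displacements of the others telescope to the displacement over \<open>[T, 1]\<close>.
\<close>

lemma curve_length_lower_bound:
  assumes A: "smooth_atlas A" "c \<in> A" and m: "m > 0"
    "\<And>y v. y \<in> K \<Longrightarrow> m * norm (tcoord A c (cinv c y) v) \<le> gnorm g (cinv c y) v"
    and pieces: "\<tau> 0 = 0" "\<tau> n = 1"
      "\<And>i. i < n \<Longrightarrow> \<tau> i < \<tau> (Suc i) \<and> C1_curve A {\<tau> i..\<tau> (Suc i)} \<gamma> (v i)"
    and T: "T \<in> {0..1}" "\<And>t. t \<in> {T..1} \<Longrightarrow> \<gamma> t \<in> cdom c \<and> cmap c (\<gamma> t) \<in> K"
  shows "ennreal (m * norm (cmap c (\<gamma> 1) - cmap c (\<gamma> T)))
    \<le> (\<Sum>i<n. \<integral>\<^sup>+t\<in>{\<tau> i..\<tau> (Suc i)}. ennreal (gnorm g (\<gamma> t) (v i t)) \<partial>lborel)"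
proof -
  define h where "h t = cmap c (\<gamma> t)" for t
  define a where "a i = max T (\<tau> i)" for i
  have le1: "\<tau> k \<le> 1" if "k \<le> n" for k
    using that
  proof (induction rule: inc_induct)
    case (step k)
    then show ?case using pieces(3)[of k] by auto
  qed (simp add: pieces)
  have piece: "ennreal (m * norm (h (a (Suc i)) - h (a i)))
      \<le> (\<integral>\<^sup>+t\<in>{\<tau> i..\<tau> (Suc i)}. ennreal (gnorm g (\<gamma> t) (v i t)) \<partial>lborel)" if i: "i < n" for i
  proof (cases "\<tau> (Suc i) \<le> T")
    case True
    then have "a (Suc i) = a i" using pieces(3)[OF i] by (auto simp: a_def)
    then show ?thesis by simp
  next
    case False
    have lt: "\<tau> i < \<tau> (Suc i)" and C1: "C1_curve A {\<tau> i..\<tau> (Suc i)} \<gamma> (v i)"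
      using pieces(3)[OF i] by auto
    have sub: "{a i..a (Suc i)} \<subseteq> {\<tau> i..\<tau> (Suc i)}" "{a i..a (Suc i)} \<subseteq> {T..1}"
      using False lt le1[of "Suc i"] i by (auto simp: a_def)
    have "ennreal (m * norm (h (a (Suc i)) - h (a i)))
      \<le> (\<integral>\<^sup>+t\<in>{a i..a (Suc i)}. ennreal (gnorm g (\<gamma> t) (v i t)) \<partial>lborel)"
    proof (rule displacement_le_nn_integral[where h' = "\<lambda>t. tcoord A c (\<gamma> t) (v i t)"])
      show "a i \<le> a (Suc i)" using lt by (auto simp: a_def)
      show "m > 0" by fact
      show "continuous_on {a i..a (Suc i)} (\<lambda>t. tcoord A c (\<gamma> t) (v i t))"
        using C1 A(2) sub T(2) unfolding C1_curve_def
        by (blast intro: continuous_on_subset)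
      fix t assume t: "t \<in> {a i..a (Suc i)}"
      then have d: "\<gamma> t \<in> cdom c" "cmap c (\<gamma> t) \<in> K" using T(2) sub by blast+
      have "(h has_vector_derivative tcoord A c (\<gamma> t) (v i t)) (at t within {\<tau> i..\<tau> (Suc i)})"
        unfolding h_def
        using has_velocity_in_chart[OF A, of \<gamma> t "{\<tau> i..\<tau> (Suc i)}" "v i t"] d(1) C1 t sub(1)
        by (auto simp: C1_curve_def)
      then show "(h has_vector_derivative tcoord A c (\<gamma> t) (v i t)) (at t within {a i..a (Suc i)})"
        by (rule has_vector_derivative_within_subset) (rule sub)
      show "ennreal (m * norm (tcoord A c (\<gamma> t) (v i t))) \<le> ennreal (gnorm g (\<gamma> t) (v i t))"
        using m(2)[OF d(2)] chart_facts(5)[OF A d(1)] by (auto intro: ennreal_leI)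
    qed
    also have "\<dots> \<le> (\<integral>\<^sup>+t\<in>{\<tau> i..\<tau> (Suc i)}. ennreal (gnorm g (\<gamma> t) (v i t)) \<partial>lborel)"
      using sub(1) by (intro nn_integral_mono) (auto simp: indicator_def)
    finally show ?thesis .
  qed
  have "ennreal (m * norm (h (a k) - h (a 0)))
      \<le> (\<Sum>i<k. \<integral>\<^sup>+t\<in>{\<tau> i..\<tau> (Suc i)}. ennreal (gnorm g (\<gamma> t) (v i t)) \<partial>lborel)" if "k \<le> n" for k
    using that
  proof (induction k)
    case 0
    then show ?case by simp
  next
    case (Suc k)
    have "norm (h (a (Suc k)) - h (a 0)) \<le> norm (h (a k) - h (a 0)) + norm (h (a (Suc k)) - h (a k))"
      using norm_triangle_ineq[of "h (a k) - h (a 0)" "h (a (Suc k)) - h (a k)"] by simp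
    then have "m * norm (h (a (Suc k)) - h (a 0))
        \<le> m * norm (h (a k) - h (a 0)) + m * norm (h (a (Suc k)) - h (a k))"
      using m(1) by (simp add: distrib_left[symmetric])
    then have "ennreal (m * norm (h (a (Suc k)) - h (a 0)))
        \<le> ennreal (m * norm (h (a k) - h (a 0))) + ennreal (m * norm (h (a (Suc k)) - h (a k)))"
      using m(1) by (metis ennreal_leI ennreal_plus less_imp_le mult_nonneg_nonneg norm_ge_zero)
    also have "\<dots> \<le> (\<Sum>i<Suc k. \<integral>\<^sup>+t\<in>{\<tau> i..\<tau> (Suc i)}. ennreal (gnorm g (\<gamma> t) (v i t)) \<partial>lborel)"
      using Suc piece[of k] by (simp add: add_mono)
    finally show ?case .
  qed
  from this[of n] show ?thesis
    using pieces(1,2) T(1) by (simp add: a_def h_def max_def split: if_splits)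
qed

text \<open>
  A curve from \<open>p\<close> to \<open>q\<close> of length less than \<open>m * \<epsilon>\<close> stays in the chart. Otherwise let \<open>T\<close> be the
  last time at which it is outside the open ball of radius \<open>2 * \<rho>\<close>. From then on it
  runs in the closed ball, where the length bounds the coordinate displacement, so at time \<open>T\<close> it
  is at distance less than \<open>\<epsilon> \<le> \<rho>\<close> from \<open>cmap c q\<close>, hence inside the open ball: a contradiction.
\<close>

lemma riemannian_dist_controls_chart_dist:
  assumes A: "smooth_atlas A" "c \<in> A" and K: "cball y0 (2 * \<rho>) \<subseteq> cimage c"
    and m: "m > 0"
    "\<And>y v. y \<in> cball y0 (2 * \<rho>) \<Longrightarrow> m * norm (tcoord A c (cinv c y) v) \<le> gnorm g (cinv c y) v"
    and q: "q \<in> cdom c" "cmap c q \<in> cball y0 \<rho>"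
    and \<epsilon>: "0 < \<epsilon>" "\<epsilon> \<le> \<rho>" and pq: "riemannian_dist A g p q < ennreal (m * \<epsilon>)"
  shows "p \<in> cdom c \<and> dist (cmap c p) (cmap c q) < \<epsilon>"
proof -
  note C = chart_facts[OF A]
  obtain \<gamma> n \<tau> v where \<gamma>: "continuous_on {0..1::real} \<gamma>" "\<gamma> 0 = p" "\<gamma> 1 = q" "\<tau> 0 = 0" "\<tau> n = 1"
      "\<And>i. i < n \<Longrightarrow> \<tau> i < \<tau> (Suc i) \<and> C1_curve A {\<tau> i..\<tau> (Suc i)} \<gamma> (v i)"
    and len: "(\<Sum>i<n. \<integral>\<^sup>+t\<in>{\<tau> i..\<tau> (Suc i)}. ennreal (gnorm g (\<gamma> t) (v i t)) \<partial>lborel) < ennreal (m * \<epsilon>)"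
    using pq unfolding riemannian_dist_def Inf_less_iff by blast
  have short: "dist (cmap c (\<gamma> T)) (cmap c q) < \<epsilon>"
    if "T \<in> {0..1}" "\<And>t. t \<in> {T..1} \<Longrightarrow> \<gamma> t \<in> cdom c \<and> cmap c (\<gamma> t) \<in> cball y0 (2 * \<rho>)" for T
  proof -
    have "ennreal (m * norm (cmap c (\<gamma> 1) - cmap c (\<gamma> T))) < ennreal (m * \<epsilon>)"
      using curve_length_lower_bound[OF A m \<gamma>(4,5,6) that] len by (rule le_less_trans) simp_all
    then show ?thesis using m(1) \<epsilon>(1) \<gamma>(3)
      by (simp add: ennreal_less_iff dist_norm norm_minus_commute)
  qed
  define U where "U = cinv c ` ball y0 (2 * \<rho>)"
  define B where "B = {t \<in> {0..1}. \<gamma> t \<notin> U}"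
  have ballK: "ball y0 (2 * \<rho>) \<subseteq> cimage c" using K ball_subset_cball by blast
  have "open U" unfolding U_def by (rule open_chart_preimage[OF A open_ball ballK])
  then have "closed ({0..1} \<inter> \<gamma> -` (- U))"
    by (intro continuous_closed_preimage[OF \<gamma>(1)] closed_Compl) auto
  moreover have "{0..1} \<inter> \<gamma> -` (- U) = B" by (auto simp: B_def)
  ultimately have "closed B" by simp
  have U: "x \<in> cdom c \<and> cmap c x \<in> ball y0 (2 * \<rho>)" if "x \<in> U" for x
    using that ballK C(7,8) unfolding U_def by force
  have inU: "x \<in> U" if "x \<in> cdom c" "cmap c x \<in> ball y0 (2 * \<rho>)" for x
    unfolding U_def using that C(5) by (metis image_eqI)
  have "q \<in> U" using q \<epsilon> by (intro inU) auto
  have "B = {}"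
  proof (rule ccontr)
    assume "B \<noteq> {}"
    have bdd: "bdd_above B" by (rule bdd_aboveI[of _ 1]) (auto simp: B_def)
    define T where "T = Sup B"
    have TB: "T \<in> B"
      unfolding T_def by (rule closed_contains_Sup) fact+
    then have "T \<noteq> 1" using \<gamma>(3) \<open>q \<in> U\<close> by (auto simp: B_def)
    then have T: "0 \<le> T" "T < 1" using TB by (auto simp: B_def)
    have after: "\<gamma> t \<in> U" if "t \<in> {T<..1}" for t
    proof -
      have "t \<notin> B" using that cSup_upper[OF _ bdd, of t] by (auto simp: T_def)
      then show ?thesis using that T by (auto simp: B_def)
    qed
    \<comment> \<open>The closed coordinate ball is compact, hence closed in the whole manifold, so the limit from
      the right at \<open>T\<close> cannot escape from the chart.\<close>
    have cpt: "compact (cinv c ` cball y0 (2 * \<rho>))"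
      by (intro compact_continuous_image continuous_on_subset[OF C(4) K]) auto
    have "\<gamma> T \<in> cinv c ` cball y0 (2 * \<rho>)"
    proof (rule Lim_in_closed_set)
      show "closed (cinv c ` cball y0 (2 * \<rho>))" by (rule compact_imp_closed[OF cpt])
      show "\<forall>\<^sub>F t in at T within {T<..1}. \<gamma> t \<in> cinv c ` cball y0 (2 * \<rho>)"
      proof -
        have "U \<subseteq> cinv c ` cball y0 (2 * \<rho>)"
          unfolding U_def by (intro image_mono ball_subset_cball)
        then have "\<forall>t\<in>{T<..1}. \<gamma> t \<in> cinv c ` cball y0 (2 * \<rho>)" using after by blast
        then show ?thesis by (simp add: eventually_at_filter)
      qed
      show "at T within {T<..1} \<noteq> bot"
        using T by (simp add: trivial_limit_within)
      have "(\<gamma> \<longlongrightarrow> \<gamma> T) (at T within {0..1})"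
        using \<gamma>(1) T unfolding continuous_on_def by auto
      then show "(\<gamma> \<longlongrightarrow> \<gamma> T) (at T within {T<..1})"
        by (rule tendsto_within_subset) (use T in auto)
    qed
    then have "\<gamma> T \<in> cdom c \<and> cmap c (\<gamma> T) \<in> cball y0 (2 * \<rho>)"
      using C(7,8) K by force
    then have all: "\<gamma> t \<in> cdom c \<and> cmap c (\<gamma> t) \<in> cball y0 (2 * \<rho>)" if "t \<in> {T..1}" for t
      using U[OF after, of t] that by (cases "t = T") auto
    have "dist (cmap c (\<gamma> T)) (cmap c q) < \<epsilon>"
      using T by (intro short all) auto
    then have "dist y0 (cmap c (\<gamma> T)) < 2 * \<rho>"
      using dist_triangle[of y0 "cmap c (\<gamma> T)" "cmap c q"] q(2) \<epsilon>(2) by (simp add: dist_commute)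
    then have "\<gamma> T \<in> U" using all[of T] T by (intro inU) auto
    then show False using TB by (simp add: B_def)
  qed
  then have inside: "\<gamma> t \<in> U" if "t \<in> {0..1}" for t
    using that unfolding B_def by blast
  then have "dist (cmap c (\<gamma> 0)) (cmap c q) < \<epsilon>"
    using U by (intro short) force+
  then show ?thesis using U[OF inside, of 0] \<gamma>(2) by simp
qed

lemma has_vector_derivative_iff_quotient:
  "(f has_vector_derivative D) (at x within S) \<longleftrightarrow>
    ((\<lambda>y. (f y - f x) /\<^sub>R (y - x)) \<longlongrightarrow> D) (at x within S)"
proof -
  have eq: "norm (f y - f x - (y - x) *\<^sub>R D) / norm (y - x) = norm ((f y - f x) /\<^sub>R (y - x) - D)"
    if "y \<noteq> x" for y
  proof -
    have "f y - f x - (y - x) *\<^sub>R D = (y - x) *\<^sub>R ((f y - f x) /\<^sub>R (y - x) - D)"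
      using that by (simp add: scaleR_diff_right)
    then have "norm (f y - f x - (y - x) *\<^sub>R D) = \<bar>y - x\<bar> * norm ((f y - f x) /\<^sub>R (y - x) - D)"
      by (metis norm_scaleR)
    then show ?thesis using that by simp
  qed
  have "((\<lambda>y. norm (f y - f x - (y - x) *\<^sub>R D) / norm (y - x)) \<longlongrightarrow> 0) (at x within S)
      \<longleftrightarrow> ((\<lambda>y. norm ((f y - f x) /\<^sub>R (y - x) - D)) \<longlongrightarrow> 0) (at x within S)"
    by (rule tendsto_cong) (unfold eventually_at_filter, rule always_eventually, use eq in blast)
  then show ?thesis
    by (simp add: has_vector_derivative_def has_derivative_iff_norm bounded_linear_scaleR_left
        LIM_zero_iff tendsto_norm_zero_iff)
qed

text \<open>
  At a fixed point \<open>y\<close> of the chart, the components of a \<open>C\<^sup>1\<close> path of vector fields form a \<open>C\<^sup>1\<close>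
  curve in the model space, whose speed is at most \<open>1 / m\<close> times the \<open>C\<^sup>0\<close> norm of its velocity field.
\<close>

lemma d_An_controls_components:
  assumes A: "smooth_atlas A" "c \<in> A" and y: "y \<in> cimage c" and m: "m > 0"
    "\<And>v. m * norm (tcoord A c (cinv c y) v) \<le> gnorm g (cinv c y) v"
  shows "ennreal (m * norm (vf_rep A c X1 y - vf_rep A c X0 y)) \<le> d_An A g r X0 X1"
  unfolding d_An_def
proof (rule Inf_greatest, clarify)
  fix P Z assume P: "C1_path_vf A r P Z"
  define h where "h s = vf_rep A c (P s) y" for s
  define h' where "h' s = vf_rep A c (Z s) y" for s
  have lin: "linear (tcoord A c (cinv c y))"
    using linear_tcoord[OF A] chart_facts(7)[OF A y] by blast
  have pt: "((\<lambda>u. vf_rep A c (W u) y) \<longlongrightarrow> vf_rep A c V y) F" if "Cr_tendsto A r W V F"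
    for W :: "real \<Rightarrow> 'a \<Rightarrow> 'b" and V F
  proof -
    have "uniform_limit {y} (\<lambda>i. iter_deriv [] (vf_rep A c (W i))) (iter_deriv [] (vf_rep A c V)) F"
      using that[unfolded Cr_tendsto_def, rule_format, OF A(2), of "{y}" "[]"] y
      by (simp add: enat_0)
    then show ?thesis by simp
  qed
  have "ennreal (m * norm (h 1 - h 0)) \<le> (\<integral>\<^sup>+s\<in>{0..1}. C0_norm g (Z s) \<partial>lborel)"
  proof (rule displacement_le_nn_integral[where h' = h'])
    show "continuous_on {0..1} h'"
      unfolding continuous_on_def h'_def using P by (auto simp: C1_path_vf_def intro!: pt)
    fix s :: real assume s: "s \<in> {0..1}"
    have "((\<lambda>u. vf_rep A c (\<lambda>x. (P u x - P s x) /\<^sub>R (u - s)) y) \<longlongrightarrow> h' s) (at s within {0..1})"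
      unfolding h'_def using P s by (intro pt) (auto simp: C1_path_vf_def)
    moreover have "vf_rep A c (\<lambda>x. (P u x - P s x) /\<^sub>R (u - s)) y = (h u - h s) /\<^sub>R (u - s)" for u
      unfolding h_def vf_rep_def by (simp add: linear_cmul[OF lin] linear_diff[OF lin])
    ultimately show "(h has_vector_derivative h' s) (at s within {0..1})"
      by (simp add: has_vector_derivative_iff_quotient)
    have "m * norm (h' s) \<le> gnorm g (cinv c y) (Z s (cinv c y))"
      using m(2) by (simp add: h'_def vf_rep_def)
    then show "ennreal (m * norm (h' s)) \<le> C0_norm g (Z s)"
      unfolding C0_norm_def by (intro SUP_upper2[of "cinv c y"] ennreal_leI) auto
  qed (use m in auto)
  then show "ennreal (m * norm (vf_rep A c (P 1) y - vf_rep A c (P 0) y))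
      \<le> (\<integral>\<^sup>+s\<in>{0..1}. C0_norm g (Z s) \<partial>lborel)"
    by (simp add: h_def)
qed

section \<open>Uniqueness of the flow of a continuously differentiable vector field\<close>

text \<open>
  Let \<open>M\<close> be the maximum of the distance between the two solutions. Their velocities differ by at
  most \<open>L * M\<close>, so the mean value inequality gives \<open>M \<le> L * (b - a) * M\<close>, and thus \<open>M = 0\<close>.
\<close>

lemma lipschitz_ode_unique:
  fixes u w :: "real \<Rightarrow> 'e::real_normed_vector"
  assumes lip: "\<And>x y. x \<in> S \<Longrightarrow> y \<in> S \<Longrightarrow> norm (F x - F y) \<le> L * norm (x - y)"
    and L: "0 \<le> L" "L * (b - a) < 1" and t0: "t0 \<in> {a..b}" "u t0 = w t0"
    and u: "\<And>t. t \<in> {a..b} \<Longrightarrow> u t \<in> S \<and> (u has_vector_derivative F (u t)) (at t within {a..b})"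
    and w: "\<And>t. t \<in> {a..b} \<Longrightarrow> w t \<in> S \<and> (w has_vector_derivative F (w t)) (at t within {a..b})"
    and t: "t \<in> {a..b}"
  shows "u t = w t"
proof -
  define f where "f s = u s - w s" for s
  have der: "(f has_vector_derivative F (u s) - F (w s)) (at s within {a..b})" if "s \<in> {a..b}" for s
    unfolding f_def using u w that by (auto intro: has_vector_derivative_diff)
  then have "continuous_on {a..b} f"
    using has_vector_derivative_continuous continuous_on_eq_continuous_within by blast
  then have "continuous_on {a..b} (\<lambda>s. norm (f s))" by (rule continuous_on_norm)
  then obtain s where s: "s \<in> {a..b}" and max: "\<And>t. t \<in> {a..b} \<Longrightarrow> norm (f t) \<le> norm (f s)"
    using continuous_attains_sup[of "{a..b}" "\<lambda>s. norm (f s)"] t0(1) by auto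
  have "norm (f s - f t0) \<le> (L * norm (f s)) * norm (s - t0)"
  proof (rule differentiable_bound[OF convex_real_interval(5)])
    fix t assume t: "t \<in> {a..b}"
    show "(f has_derivative (\<lambda>x. x *\<^sub>R (F (u t) - F (w t)))) (at t within {a..b})"
      using der[OF t] by (simp add: has_vector_derivative_def)
    have "norm (F (u t) - F (w t)) \<le> L * norm (f t)"
      using lip u w t by (simp add: f_def)
    also have "\<dots> \<le> L * norm (f s)" using max[OF t] L by (intro mult_left_mono) auto
    finally show "onorm (\<lambda>x. x *\<^sub>R (F (u t) - F (w t))) \<le> L * norm (f s)"
      by (intro onorm_bound) (auto simp: L mult.commute mult_left_mono)
  qed (use s t0 in auto)
  also have "\<dots> \<le> (L * norm (f s)) * (b - a)"
    using s t0 L by (intro mult_left_mono) auto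
  finally have "norm (f s) * (1 - L * (b - a)) \<le> 0" using t0 by (simp add: f_def algebra_simps)
  then have "norm (f s) \<le> 0" using L(2) by (simp add: mult_le_0_iff)
  then show ?thesis using max[OF t] by (simp add: f_def)
qed

lemma Cr_on_locally_lipschitz:
  fixes F :: "'a::euclidean_space \<Rightarrow> 'b::real_normed_vector"
  assumes F: "Cr_on r S F" and r: "1 \<le> r" and S: "open S" "y \<in> S"
  obtains \<rho> L where "0 < \<rho>" "0 \<le> L" "cball y \<rho> \<subseteq> S"
    "\<And>x x'. x \<in> cball y \<rho> \<Longrightarrow> x' \<in> cball y \<rho> \<Longrightarrow> norm (F x - F x') \<le> L * norm (x - x')"
proof -
  obtain \<rho> where \<rho>: "0 < \<rho>" "cball y \<rho> \<subseteq> S"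
    using S open_contains_cball by blast
  define F' where "F' x = frechet_derivative F (at x)" for x
  have "enat (length ([]::'a list)) < r"
    using r by (metis enat_0 i0_less list.size(3) not_one_le_zero)
  then have "\<forall>x\<in>S. iter_deriv [] F differentiable (at x)"
    using F unfolding Cr_on_def by blast
  then have der: "(F has_derivative F' x) (at x)" if "x \<in> S" for x
    using that using frechet_derivative_works by (auto simp: F'_def)
  have cont: "continuous_on S (\<lambda>x. F' x v)" for v
  proof -
    have "enat (length [v]) \<le> r" using r by (simp add: one_enat_def)
    then have "continuous_on S (iter_deriv [v] F)" using F unfolding Cr_on_def by blast
    then show ?thesis by (simp add: F'_def)
  qed
  have "\<exists>M. \<forall>x\<in>cball y \<rho>. norm (F' x v) \<le> M" for v
  proof -
    have "compact ((\<lambda>x. F' x v) ` cball y \<rho>)"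
      by (intro compact_continuous_image continuous_on_subset[OF cont \<rho>(2)]) auto
    then have "bounded ((\<lambda>x. F' x v) ` cball y \<rho>)" by (rule compact_imp_bounded)
    then show ?thesis by (simp add: bounded_iff)
  qed
  then obtain M where M: "\<And>v x. x \<in> cball y \<rho> \<Longrightarrow> norm (F' x v) \<le> M v" by metis
  define L where "L = (\<Sum>v\<in>Basis. M v)"
  have M0: "0 \<le> M v" for v using M[of y v] \<rho>(1) norm_ge_zero order_trans by (metis centre_in_cball less_imp_le)
  have L: "0 \<le> L" unfolding L_def using M0 by (intro sum_nonneg) auto
  have on: "onorm (F' x) \<le> L" if x: "x \<in> cball y \<rho>" for x
  proof -
    have "onorm (F' x) \<le> (\<Sum>v\<in>Basis. norm (F' x v))"
      using der \<rho>(2) x has_derivative_bounded_linear by (blast intro: onorm_componentwise)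
    also have "\<dots> \<le> L" unfolding L_def by (rule sum_mono) (rule M[OF x])
    finally show ?thesis .
  qed
  show ?thesis
  proof (rule that[OF \<rho>(1) L \<rho>(2)])
    have der': "(F has_derivative F' z) (at z within cball y \<rho>)" if "z \<in> cball y \<rho>" for z
      using der that \<rho>(2) by (blast intro: has_derivative_at_withinI)
    show "norm (F x - F x') \<le> L * norm (x - x')"
      if "x \<in> cball y \<rho>" "x' \<in> cball y \<rho>" for x x'
      by (rule differentiable_bound[OF convex_cball der' on that])
  qed
qed

lemma generates_curve_in_chart:
  assumes A: "smooth_atlas A" "c \<in> A" and \<phi>: "generates A Y \<phi>" and d: "\<phi> t x \<in> cdom c"
  shows "((\<lambda>s. cmap c (\<phi> s x)) has_vector_derivative vf_rep A c Y (cmap c (\<phi> t x))) (at t)"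
    and "continuous_on UNIV (\<lambda>s. \<phi> s x)"
proof -
  have "continuous_on UNIV (\<lambda>(t, x). \<phi> t x)"
    using \<phi> by (simp add: generates_def continuous_flow_def)
  then have "continuous_on UNIV (\<lambda>s. (\<lambda>(t, x). \<phi> t x) (s, x))"
    by (rule continuous_on_compose2) (auto intro!: continuous_intros)
  then show cont: "continuous_on UNIV (\<lambda>s. \<phi> s x)" by simp
  have "has_velocity A (\<lambda>s. \<phi> s x) (Y (\<phi> t x)) t UNIV"
    using \<phi> by (simp add: generates_def)
  from has_velocity_in_chart[where \<gamma> = "\<lambda>s. \<phi> s x", OF A d cont UNIV_I this]
  show "((\<lambda>s. cmap c (\<phi> s x)) has_vector_derivative vf_rep A c Y (cmap c (\<phi> t x))) (at t)"
    by (simp add: vf_rep_def chart_facts(5)[OF A d])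
qed

text \<open>
  The times at which two orbits of \<open>x\<close> agree form a closed set, which is open by local
  uniqueness in a chart and contains \<open>0\<close>.
\<close>

lemma flow_unique:
  assumes A: "smooth_atlas A" and Y: "Cr_vector_field A r Y" "1 \<le> r"
    and \<phi>: "generates A Y \<phi>" and \<phi>': "generates A Y \<phi>'"
  shows "\<phi> = \<phi>'"
proof (intro ext)
  fix t x
  note at = chart_at[OF A]
  have cont: "continuous_on UNIV (\<lambda>s. \<phi> s x)" "continuous_on UNIV (\<lambda>s. \<phi>' s x)"
    using generates_curve_in_chart(2)[OF A at(1) \<phi> at(2)]
      generates_curve_in_chart(2)[OF A at(1) \<phi>' at(2)] by auto
  define S where "S = {s. \<phi> s x = \<phi>' s x}"
  have "closed S" unfolding S_def by (rule closed_Collect_eq[OF cont])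
  moreover have "open S"
  proof (rule openI)
    fix t0 assume "t0 \<in> S"
    then have t0: "\<phi> t0 x = \<phi>' t0 x" by (simp add: S_def)
    define c where "c = chart_at A (\<phi> t0 x)"
    have c: "c \<in> A" "\<phi> t0 x \<in> cdom c" using at by (auto simp: c_def)
    note C = chart_facts[OF A c(1)]
    define y where "y = cmap c (\<phi> t0 x)"
    have y: "y \<in> cimage c" using C(6) c(2) by (simp add: y_def)
    have "Cr_on r (cimage c) (vf_rep A c Y)" using Y c(1) by (simp add: Cr_vector_field_def)
    from Cr_on_locally_lipschitz[OF this Y(2) C(2) y]
    obtain \<rho> L where \<rho>: "0 < \<rho>" "0 \<le> L" "cball y \<rho> \<subseteq> cimage c"
      and lip: "\<And>z z'. z \<in> cball y \<rho> \<Longrightarrow> z' \<in> cball y \<rho> \<Longrightarrow>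
        norm (vf_rep A c Y z - vf_rep A c Y z') \<le> L * norm (z - z')" by metis
    have sub: "ball y \<rho> \<subseteq> cimage c" using \<rho>(3) ball_subset_cball by blast
    define U where "U = cinv c ` ball y \<rho>"
    have U: "p \<in> cdom c \<and> cmap c p \<in> cball y \<rho>" if "p \<in> U" for p
      using that sub C(7,8) unfolding U_def by force
    have "open U" unfolding U_def by (rule open_chart_preimage[OF A c(1) open_ball sub])
    then have "open ((\<lambda>s. \<phi> s x) -` U \<inter> (\<lambda>s. \<phi>' s x) -` U)"
      using cont by (intro open_Int open_vimage)
    moreover have "\<phi> t0 x \<in> U"
      unfolding U_def using C(5)[OF c(2)] \<rho>(1) by (intro image_eqI[of _ _ y]) (auto simp: y_def)
    ultimately obtain e where e: "0 < e" "cball t0 e \<subseteq> (\<lambda>s. \<phi> s x) -` U \<inter> (\<lambda>s. \<phi>' s x) -` U"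
      using t0 unfolding open_contains_cball by (metis IntI vimageI)
    \<comment> \<open>The time interval has length \<open>2 * \<delta>\<close>, which must be less than \<open>1 / L\<close>; the summand \<open>1\<close> covers
      the case \<open>L = 0\<close>.\<close>
    define \<delta> where "\<delta> = min e (1 / (4 * (L + 1)))"
    have \<delta>: "0 < \<delta>" using e(1) \<rho>(2) by (simp add: \<delta>_def)
    have "L * ((t0 + \<delta>) - (t0 - \<delta>)) \<le> L * (2 * (1 / (4 * (L + 1))))"
      using \<rho>(2) by (intro mult_left_mono) (auto simp: \<delta>_def)
    also have "\<dots> < 1" using \<rho>(2) by (simp add: field_simps)
    finally have small: "L * ((t0 + \<delta>) - (t0 - \<delta>)) < 1" .
    have inU: "\<phi> s x \<in> U" "\<phi>' s x \<in> U" if "s \<in> {t0 - \<delta>..t0 + \<delta>}" for s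
    proof -
      have "s \<in> cball t0 e" using that by (auto simp: \<delta>_def dist_real_def)
      then show "\<phi> s x \<in> U" "\<phi>' s x \<in> U" using e(2) by auto
    qed
    have inS: "s \<in> S" if s: "s \<in> {t0 - \<delta>..t0 + \<delta>}" for s
    proof -
      have eq: "cmap c (\<phi> s x) = cmap c (\<phi>' s x)"
      proof (rule lipschitz_ode_unique[OF lip \<rho>(2) small _ _ _ _ s, where ?t0.0 = t0])
        show "t0 \<in> {t0 - \<delta>..t0 + \<delta>}" using \<delta> by simp
        show "cmap c (\<phi> t0 x) = cmap c (\<phi>' t0 x)" by (simp add: t0)
        fix s assume s: "s \<in> {t0 - \<delta>..t0 + \<delta>}"
        note V = U[OF inU(1)[OF s]] U[OF inU(2)[OF s]]
        show "cmap c (\<phi> s x) \<in> cball y \<rho> \<and> ((\<lambda>s. cmap c (\<phi> s x)) has_vector_derivative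
            vf_rep A c Y (cmap c (\<phi> s x))) (at s within {t0 - \<delta>..t0 + \<delta>})"
          using V generates_curve_in_chart(1)[OF A c(1) \<phi>] has_vector_derivative_at_within by blast
        show "cmap c (\<phi>' s x) \<in> cball y \<rho> \<and> ((\<lambda>s. cmap c (\<phi>' s x)) has_vector_derivative
            vf_rep A c Y (cmap c (\<phi>' s x))) (at s within {t0 - \<delta>..t0 + \<delta>})"
          using V generates_curve_in_chart(1)[OF A c(1) \<phi>'] has_vector_derivative_at_within by blast
      qed auto
      have "\<phi> s x \<in> cdom c" "\<phi>' s x \<in> cdom c" using U inU[OF s] by blast+
      then have "\<phi> s x = \<phi>' s x" using C(5) eq by metis
      then show ?thesis by (simp add: S_def)
    qed
    have "ball t0 \<delta> \<subseteq> S" by (intro subsetI inS) (auto simp: dist_real_def)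
    then show "\<exists>T>0. ball t0 T \<subseteq> S" using \<delta> by blast
  qed
  moreover have "0 \<in> S"
    using \<phi> \<phi>' by (simp add: S_def generates_def continuous_flow_def)
  ultimately have "S = UNIV" using clopen by blast
  then show "\<phi> t x = \<phi>' t x" by (auto simp: S_def)
qed

section \<open>The vector field of the limit flow\<close>

text \<open>
  In a chart at \<open>x\<close>, write \<open>h\<close> for the orbit of \<open>x\<close> under \<open>\<theta>\<close>, \<open>F\<close> for the components of \<open>Y\<close>,
  and \<open>k\<close> for the orbit under \<open>\<phi> i\<close>. On a small ball around \<open>y0\<close> the components of \<open>Xs i\<close> differ
  from \<open>F y0\<close> by at most \<open>e\<close> if \<open>i\<close> is large: one half of \<open>e\<close> bounds the variation of \<open>F\<close>, the other
  half the difference of \<open>Xs i\<close> and \<open>Y\<close>. Hence \<open>k s - y0 - s *\<^sub>R F y0\<close> is at most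
  \<open>e * \<bar>s\<bar>\<close> for all \<open>s\<close> in an interval that does not depend on \<open>i\<close>, and this passes to the limit \<open>h\<close>,
  which says that \<open>F y0\<close> is the derivative of \<open>h\<close> at \<open>0\<close>.
\<close>

lemma velocity_of_limit_flow:
  assumes A: "smooth_atlas A" and g: "riemannian_metric A g"
    and gen: "\<And>i::nat. generates A (Xs i) (\<phi> i)"
    and Y: "Cr_vector_field A r Y" and \<theta>: "generates A X \<theta>"
    and flows: "(\<lambda>i. SUP t\<in>{-1..1}. C0_dist A g (\<phi> i t) (\<theta> t)) \<longlonglongrightarrow> 0"
    and fields: "(\<lambda>i. d_An A g r (Xs i) Y) \<longlonglongrightarrow> 0"
  shows "X x = Y x"
proof -
  define c where "c = chart_at A x"
  have c: "c \<in> A" "x \<in> cdom c" using chart_at[OF A] by (auto simp: c_def)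
  note C = chart_facts[OF A c(1)]
  define y0 where "y0 = cmap c x"
  define F where "F = vf_rep A c Y"
  define h where "h s = cmap c (\<theta> s x)" for s
  have y0: "y0 \<in> cimage c" using C(6) c(2) by (simp add: y0_def)
  have rep0: "vf_rep A c Z y0 = Z x" for Z
    using tcoord_chart_at[OF A] C(5)[OF c(2)] by (simp add: vf_rep_def y0_def c_def)
  have \<theta>0: "\<theta> 0 x = x" using \<theta> by (simp add: generates_def continuous_flow_def)
  have h0: "h 0 = y0" by (simp add: h_def \<theta>0 y0_def)
  have contF: "continuous_on (cimage c) F"
  proof -
    have "\<forall>vs. enat (length vs) \<le> r \<longrightarrow> continuous_on (cimage c) (iter_deriv vs F)"
      using Y c(1) by (simp add: Cr_vector_field_def Cr_on_def F_def)
    from this[rule_format, of "[]"] show ?thesis by (simp flip: zero_enat_def)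
  qed
  have linear_approx: "\<exists>t0>0. \<forall>s. norm (s - 0) < t0 \<longrightarrow>
      norm (h s - h 0 - (s - 0) *\<^sub>R F y0) \<le> e * norm (s - 0)" if "e > 0" for e
  proof -
    define \<epsilon> where "\<epsilon> = e / 2"
    have \<epsilon>: "\<epsilon> > 0" using that by (simp add: \<epsilon>_def)
    obtain \<delta> where \<delta>: "\<delta> > 0" "\<And>y. y \<in> cimage c \<Longrightarrow> dist y y0 < \<delta> \<Longrightarrow> dist (F y) (F y0) < \<epsilon>"
      using contF \<epsilon> y0 unfolding continuous_on_iff by metis
    obtain R where R: "R > 0" "cball y0 R \<subseteq> cimage c"
      using C(2) y0 open_contains_cball by blast
    \<comment> \<open>The orbit under \<open>\<theta>\<close> is kept in the ball of radius \<open>\<rho>\<close>; nearby orbits then stay in the ball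
      of radius \<open>2 * \<rho>\<close>, on which all estimates hold.\<close>
    define \<rho> where "\<rho> = min (R / 2) (\<delta> / 3)"
    have \<rho>: "\<rho> > 0" "2 * \<rho> \<le> R" "2 * \<rho> < \<delta>" using R(1) \<delta>(1) by (auto simp: \<rho>_def)
    have K: "cball y0 (2 * \<rho>) \<subseteq> cimage c"
      using subset_cball[OF \<rho>(2)] R(2) by blast
    have F: "norm (F y - F y0) \<le> \<epsilon>" if "y \<in> cball y0 (2 * \<rho>)" for y
      using \<delta>(2)[of y] that K \<rho>(3) by (force simp: dist_norm norm_minus_commute)
    obtain m where m: "m > 0"
      "\<And>y v. y \<in> cball y0 (2 * \<rho>) \<Longrightarrow> m * norm (tcoord A c (cinv c y) v) \<le> gnorm g (cinv c y) v"
      using gnorm_lower_bound[OF A c(1) g compact_cball K] by metis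
    define U where "U = cinv c ` ball y0 \<rho>"
    have sub: "ball y0 \<rho> \<subseteq> cimage c" using K \<rho>(1) by (auto simp: subset_iff)
    have U: "p \<in> cdom c \<and> cmap c p \<in> cball y0 \<rho>" if "p \<in> U" for p
      using that sub C(7,8) unfolding U_def by force
    have "open U" unfolding U_def by (rule open_chart_preimage[OF A c(1) open_ball sub])
    then have "open ((\<lambda>s. \<theta> s x) -` U)"
      using generates_curve_in_chart(2)[OF A chart_at(1)[OF A] \<theta> chart_at(2)[OF A]]
      by (rule open_vimage)
    moreover have "\<theta> 0 x \<in> U"
      unfolding U_def \<theta>0 using C(5)[OF c(2)] \<rho>(1)
      by (intro image_eqI[of _ _ y0]) (auto simp: y0_def)
    ultimately obtain t1 where t1: "t1 > 0" "cball 0 t1 \<subseteq> (\<lambda>s. \<theta> s x) -` U"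
      unfolding open_contains_cball by (metis vimageI)
    define t0 where "t0 = min t1 1"
    have t0: "t0 > 0" using t1(1) by (simp add: t0_def)
    have near: "\<theta> s x \<in> cdom c" "h s \<in> cball y0 \<rho>" if "s \<in> {-t0..t0}" for s
    proof -
      have "s \<in> cball 0 t1" using that by (auto simp: t0_def dist_real_def)
      then have "\<theta> s x \<in> U" using t1(2) by auto
      then show "\<theta> s x \<in> cdom c" "h s \<in> cball y0 \<rho>" using U by (auto simp: h_def)
    qed
    have approx: "norm (h s - y0 - s *\<^sub>R F y0) \<le> e * \<bar>s\<bar> + \<eta>"
      if s: "s \<in> {-t0..t0}" and \<eta>: "0 < \<eta>" "\<eta> \<le> \<rho>" for s \<eta>
    proof -
      have "\<forall>\<^sub>F i in sequentially. (SUP t\<in>{-1..1}. C0_dist A g (\<phi> i t) (\<theta> t)) < ennreal (m * \<eta>)"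
        using m(1) \<eta>(1) by (intro order_tendstoD(2)[OF flows]) simp
      moreover have "\<forall>\<^sub>F i in sequentially. d_An A g r (Xs i) Y < ennreal (m * \<epsilon>)"
        using m(1) \<epsilon> by (intro order_tendstoD(2)[OF fields]) simp
      ultimately have "\<forall>\<^sub>F i in sequentially.
          (SUP t\<in>{-1..1}. C0_dist A g (\<phi> i t) (\<theta> t)) < ennreal (m * \<eta>) \<and>
          d_An A g r (Xs i) Y < ennreal (m * \<epsilon>)"
        by (rule eventually_conj)
      then obtain i where i: "(SUP t\<in>{-1..1}. C0_dist A g (\<phi> i t) (\<theta> t)) < ennreal (m * \<eta>)"
          "d_An A g r (Xs i) Y < ennreal (m * \<epsilon>)"
        using eventually_happens'[OF sequentially_bot] by blast
      define k where "k s = cmap c (\<phi> i s x)" for s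
      have close: "\<phi> i s x \<in> cdom c \<and> dist (k s) (h s) < \<eta>" if "s \<in> {-t0..t0}" for s
      proof -
        have "s \<in> {-1..1}" using that by (auto simp: t0_def)
        then have "C0_dist A g (\<phi> i s) (\<theta> s) \<le> (SUP t\<in>{-1..1}. C0_dist A g (\<phi> i t) (\<theta> t))"
          by (rule SUP_upper)
        moreover have "riemannian_dist A g (\<phi> i s x) (\<theta> s x) \<le> C0_dist A g (\<phi> i s) (\<theta> s)"
          unfolding C0_dist_def by (rule SUP_upper) simp
        ultimately have "riemannian_dist A g (\<phi> i s x) (\<theta> s x) < ennreal (m * \<eta>)"
          using i(1) by (meson le_less_trans)
        from riemannian_dist_controls_chart_dist[OF A c(1) K m near(1)[OF that] _ \<eta> this]
        show ?thesis using near(2)[OF that] by (simp add: k_def h_def)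
      qed
      have inK: "k s \<in> cball y0 (2 * \<rho>)" if "s \<in> {-t0..t0}" for s
        using close[OF that] near(2)[OF that] \<eta>(2) dist_triangle[of y0 "k s" "h s"]
        by (simp add: dist_commute)
      have speed: "norm (vf_rep A c (Xs i) y - F y0) \<le> e" if y: "y \<in> cball y0 (2 * \<rho>)" for y
      proof -
        have "ennreal (m * norm (F y - vf_rep A c (Xs i) y)) < ennreal (m * \<epsilon>)"
          unfolding F_def
          using d_An_controls_components[OF A c(1) subsetD[OF K y] m(1) m(2)[OF y]] i(2)
          by (rule le_less_trans)
        then have "norm (F y - vf_rep A c (Xs i) y) < \<epsilon>"
          using m(1) \<epsilon> by (simp add: ennreal_less_iff)
        then show ?thesis
          using F[OF y] norm_triangle_ineq[of "vf_rep A c (Xs i) y - F y" "F y - F y0"]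
          by (simp add: \<epsilon>_def norm_minus_commute)
      qed
      define f where "f s = k s - s *\<^sub>R F y0" for s
      have "norm (f s - f 0) \<le> e * norm (s - 0)"
      proof (rule differentiable_bound[OF convex_real_interval(5)])
        fix t assume t: "t \<in> {-t0..t0}"
        have "(k has_vector_derivative vf_rep A c (Xs i) (k t)) (at t within {-t0..t0})"
          unfolding k_def using generates_curve_in_chart(1)[OF A c(1) gen] close[OF t]
          by (blast intro: has_vector_derivative_at_within)
        then have "(f has_vector_derivative (vf_rep A c (Xs i) (k t) - F y0)) (at t within {-t0..t0})"
          unfolding f_def by (auto intro!: derivative_eq_intros)
        then show "(f has_derivative (\<lambda>z. z *\<^sub>R (vf_rep A c (Xs i) (k t) - F y0))) (at t within {-t0..t0})"
          by (simp add: has_vector_derivative_def)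
        show "onorm (\<lambda>z. z *\<^sub>R (vf_rep A c (Xs i) (k t) - F y0)) \<le> e"
          using speed[OF inK[OF t]] that \<open>e > 0\<close>
          by (intro onorm_bound) (auto simp: mult.commute[of e] intro: mult_left_mono)
      qed (use s t0 in auto)
      moreover have "k 0 = y0"
        using gen[of i] by (simp add: k_def y0_def generates_def continuous_flow_def)
      moreover have "norm (h s - k s) \<le> \<eta>"
        using close[OF s] by (simp add: dist_norm norm_minus_commute)
      ultimately show ?thesis
        using norm_triangle_ineq[of "k s - y0 - s *\<^sub>R F y0" "h s - k s"]
        by (simp add: f_def algebra_simps)
    qed
    have bound: "norm (h s - y0 - s *\<^sub>R F y0) \<le> e * \<bar>s\<bar>" if s: "s \<in> {-t0..t0}" for s
    proof (rule field_le_epsilon)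
      fix \<eta> :: real assume "\<eta> > 0"
      then show "norm (h s - y0 - s *\<^sub>R F y0) \<le> e * \<bar>s\<bar> + \<eta>"
        using approx[OF s, of "min \<eta> \<rho>"] \<rho>(1) by simp
    qed
    show ?thesis
      using t0 by (intro exI[of _ t0]) (auto simp: h0 intro!: bound)
  qed
  have "(h has_vector_derivative F y0) (at 0)"
    unfolding has_vector_derivative_def has_derivative_at_alt
    using linear_approx by (auto simp: bounded_linear_scaleR_left)
  moreover have "(h has_vector_derivative vf_rep A c X y0) (at 0)"
    using generates_curve_in_chart(1)[OF A c(1) \<theta>, of 0 x] c(2)
    by (simp add: h_def[abs_def] \<theta>0 y0_def)
  ultimately have "vf_rep A c X y0 = F y0" by (metis vector_derivative_unique_at)
  then show ?thesis by (simp add: F_def rep0)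
qed

theorem proposition5p7:
  fixes A :: "('m::{t2_space,second_countable_topology}, 'e::euclidean_space) chart set"
    and g :: "'m \<Rightarrow> 'e \<Rightarrow> 'e \<Rightarrow> real"
    and r :: enat
    and Xs :: "nat \<Rightarrow> 'm \<Rightarrow> 'e" and \<phi> :: "nat \<Rightarrow> real \<Rightarrow> 'm \<Rightarrow> 'm"
    and Y :: "'m \<Rightarrow> 'e" and \<psi> :: "real \<Rightarrow> 'm \<Rightarrow> 'm"
    and X :: "'m \<Rightarrow> 'e" and \<theta> :: "real \<Rightarrow> 'm \<Rightarrow> 'm"
  assumes "smooth_atlas A" and "compact (UNIV :: 'm set)"
    and "riemannian_metric A g"
    and "1 \<le> r"
    and "\<And>i. Xs i \<in> An A g r" and "\<And>i. generates A (Xs i) (\<phi> i)"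
    and "Y \<in> An A g r" and "generates A Y \<psi>"
    and "Cr_vector_field A 0 X" and "generates A X \<theta>"
    and "\<And>T::real. T > 0 \<Longrightarrow>
           (\<lambda>i. SUP t\<in>{-T..T}. C0_dist A g (\<phi> i t) (\<theta> t)) \<longlonglongrightarrow> 0"
    and "(\<lambda>i. d_An A g r (Xs i) Y) \<longlonglongrightarrow> 0"
  shows "X = Y \<and> \<theta> = \<psi> \<and> anosov_flow A g r \<theta>"
proof -
  obtain \<psi>' where \<psi>': "anosov_generates A g r Y \<psi>'"
    using assms(7) by (auto simp: An_def)
  then have Y: "Cr_vector_field A r Y" "generates A Y \<psi>'"
    by (auto simp: anosov_generates_def)
  have "X = Y"
    using velocity_of_limit_flow[OF assms(1,3,6) Y(1) assms(10) assms(11)[OF zero_less_one] assms(12)]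
    by (rule ext)
  moreover from this have "\<theta> = \<psi>" "\<theta> = \<psi>'"
    using flow_unique[OF assms(1) Y(1) assms(4)] assms(8,10) Y(2) by blast+
  ultimately show ?thesis
    using \<psi>' by (auto simp: anosov_flow_def)
qed

end
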